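(* Let $\mathbb{X}=(X,g,\xi)$ be a gm-space with $X\subset\mathbb{R}^d$ bounded and $\xi$ absolutely continuous with respect to Lebesgue measure on $\mathbb{R}^d$. If $g(x,x')=\|x-x'\|$ or $g(x,x')=\|x-x'\|^2$, then $\mathrm{q}_n^{\mathrm{GW}}(\mathbb{X})\asymp n^{-1/d}$, that is, $$\limsup_{n\to\infty}n^{1/d}\,\mathrm{q}_n^{\mathrm{GW}}(\mathbb{X})<\infty\qquad\text{and}\qquad\liminf_{n\to\infty}n^{1/d}\,\mathrm{q}_n^{\mathrm{GW}}(\mathbb{X})>0.$$
   Context: A gauged measure space (gm-space) is a triple $(X,g,\xi)$ where $X$ is a Polish space, $\xi$ is a Borel probability measure on $X$, and the gauge $g\in L^2(X\times X,\xi\otimes\xi)$ is symmetric. For gm-spaces $\mathbb{X}=(X,g,\xi)$ and $\mathbb{Y}=(Y,h,\upsilon)$, with $\Pi(\xi,\upsilon)$ the set of couplings of $\xi$ and $\upsilon$, $$\mathrm{GW}_2(\mathbb{X},\mathbb{Y})=\inf_{\pi\in\Pi(\xi,\upsilon)}\Big(\iint_{(X\times Y)^2}|g(x,x')-h(y,y')|^2\,\mathrm{d}\pi(x,y)\,\mathrm{d}\pi(x',y')\Big)^{1/2}.$$ Write $[n]=\{1,\dots,n\}$. $\mathfrak{GM}_n$ is the set of gm-spaces $([n],G,\upsilon)$ with $G\in\mathbb{R}^{n\times n}$ symmetric (viewed as the gauge $(i,i')\mapsto G_{i,i'}$) and $\upsilon$ a probability measure on $[n]$; $\mathrm{q}_n^{\mathrm{GW}}(\mathbb{X}):=\inf_{\mathbb{Y}\in\mathfrak{GM}_n}\mathrm{GW}_2(\mathbb{X},\mathbb{Y})$.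 $\|\cdot\|$ is the Euclidean norm. *)

theory Defs
  imports "HOL-Probability.Probability"
begin

definition polish_topology :: "'a topology \<Rightarrow> bool" where
  "polish_topology T \<longleftrightarrow> completely_metrizable_space T \<and> separable_space T"

definition borel_sigma :: "'a topology \<Rightarrow> 'a measure" where
  "borel_sigma T = sigma (topspace T) {U. openin T U}"

record 'a gm =
  gm_top :: "'a topology"
  gauge :: "'a \<Rightarrow> 'a \<Rightarrow> real"
  gm_measure :: "'a measure"

text \<open>
  The underlying set is the carrier of the topology. The gauge is a representative of a class
  in \<open>L\<^sup>2(\<xi> \<otimes> \<xi>)\<close>, so symmetry is required almost everywhere only; its values off the carrier
  are irrelevant.
\<close>

definition gm_space :: "'a gm \<Rightarrow> bool" where
  "gm_space \<X> \<longleftrightarrow>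
     (let T = gm_top \<X>; g = gauge \<X>; \<xi> = gm_measure \<X> in
        polish_topology T \<and>
        sets \<xi> = sets (borel_sigma T) \<and> prob_space \<xi> \<and>
        (\<lambda>(x, x'). g x x') \<in> borel_measurable (\<xi> \<Otimes>\<^sub>M \<xi>) \<and>
        integrable (\<xi> \<Otimes>\<^sub>M \<xi>) (\<lambda>(x, x'). (g x x')\<^sup>2) \<and>
        (AE (x, x') in \<xi> \<Otimes>\<^sub>M \<xi>. g x x' = g x' x))"

definition couplings :: "'a measure \<Rightarrow> 'b measure \<Rightarrow> ('a \<times> 'b) measure set" where
  "couplings \<xi> \<upsilon> =
     {\<pi>. sets \<pi> = sets (\<xi> \<Otimes>\<^sub>M \<upsilon>) \<and> distr \<pi> \<xi> fst = \<xi> \<and> distr \<pi> \<upsilon> snd = \<upsilon>}"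

text \<open>
  For gm-spaces the integrand is integrable for every coupling (lemma \<open>GW2_integrable\<close> below) and
  couplings exist, so neither the default value of the Bochner integral nor that of the
  real-valued infimum is ever used.
\<close>

definition GW2 :: "'a gm \<Rightarrow> 'b gm \<Rightarrow> real" where
  "GW2 \<X> \<Y> =
     (INF \<pi>\<in>couplings (gm_measure \<X>) (gm_measure \<Y>).
        sqrt (\<integral>((x, y), (x', y')). \<bar>gauge \<X> x x' - gauge \<Y> y y'\<bar>\<^sup>2 \<partial>(\<pi> \<Otimes>\<^sub>M \<pi>)))"

definition GM :: "nat \<Rightarrow> nat gm set" where
  "GM n = {\<Y>. gm_space \<Y> \<and> gm_top \<Y> = discrete_topology {1..n} \<and>
             (\<forall>i\<in>{1..n}. \<forall>j\<in>{1..n}. gauge \<Y> i j = gauge \<Y> j i)}"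

text \<open>\<open>GM 0\<close> is empty, so \<open>q_GW 0\<close> is a meaningless default value.\<close>

definition q_GW :: "nat \<Rightarrow> 'a gm \<Rightarrow> real" where
  "q_GW n \<X> = (INF \<Y>\<in>GM n. GW2 \<X> \<Y>)"

lemma couplings_prob_space:
  assumes "prob_space \<xi>" "\<pi> \<in> couplings \<xi> \<upsilon>"
  shows "prob_space \<pi>"
proof -
  have s: "sets \<pi> = sets (\<xi> \<Otimes>\<^sub>M \<upsilon>)" and d: "distr \<pi> \<xi> fst = \<xi>"
    using assms(2) by (auto simp: couplings_def)
  have "fst \<in> measurable \<pi> \<xi>"
    using s by (simp cong: measurable_cong_sets)
  then show ?thesis
    using assms(1) d by (metis prob_space_distrD)
qed

lemma pair_in_couplings:
  assumes "prob_space \<xi>" "prob_space \<upsilon>"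
  shows "\<xi> \<Otimes>\<^sub>M \<upsilon> \<in> couplings \<xi> \<upsilon>"
proof -
  interpret A: prob_space \<xi> by fact
  interpret B: prob_space \<upsilon> by fact
  interpret P: pair_prob_space \<xi> \<upsilon> ..
  have "distr (\<xi> \<Otimes>\<^sub>M \<upsilon>) \<upsilon> snd = \<upsilon>"
  proof (rule measure_eqI)
    fix A assume "A \<in> sets (distr (\<xi> \<Otimes>\<^sub>M \<upsilon>) \<upsilon> snd)"
    then have A: "A \<in> sets \<upsilon>" by simp
    have "snd -` A \<inter> space (\<xi> \<Otimes>\<^sub>M \<upsilon>) = space \<xi> \<times> A"
      using sets.sets_into_space[OF A] by (auto simp: space_pair_measure)
    then show "emeasure (distr (\<xi> \<Otimes>\<^sub>M \<upsilon>) \<upsilon> snd) A = emeasure \<upsilon> A"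
      using A by (simp add: emeasure_distr B.emeasure_pair_measure_Times A.emeasure_space_1)
  qed simp
  moreover have "distr (\<xi> \<Otimes>\<^sub>M \<upsilon>) \<xi> fst = \<xi>"
    using B.distr_pair_fst[of \<xi>] by simp
  ultimately show ?thesis by (simp add: couplings_def)
qed

lemma GW2_integrable:
  assumes X: "gm_space \<X>" and Y: "gm_space \<Y>"
    and \<pi>: "\<pi> \<in> couplings (gm_measure \<X>) (gm_measure \<Y>)"
  shows "integrable (\<pi> \<Otimes>\<^sub>M \<pi>) (\<lambda>((x, y), (x', y')). \<bar>gauge \<X> x x' - gauge \<Y> y y'\<bar>\<^sup>2)"
proof -
  let ?\<xi> = "gm_measure \<X>" and ?\<upsilon> = "gm_measure \<Y>"
  let ?g = "\<lambda>(x, x'). gauge \<X> x x'" and ?h = "\<lambda>(y, y'). gauge \<Y> y y'"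
  have s: "sets \<pi> = sets (?\<xi> \<Otimes>\<^sub>M ?\<upsilon>)" and d: "distr \<pi> ?\<xi> fst = ?\<xi>" "distr \<pi> ?\<upsilon> snd = ?\<upsilon>"
    using \<pi> by (auto simp: couplings_def)
  have m [measurable]: "fst \<in> measurable \<pi> ?\<xi>" "snd \<in> measurable \<pi> ?\<upsilon>"
    using s by (simp_all cong: measurable_cong_sets)
  have px: "prob_space ?\<xi>" and py: "prob_space ?\<upsilon>"
    and g [measurable]: "?g \<in> borel_measurable (?\<xi> \<Otimes>\<^sub>M ?\<xi>)"
    and h [measurable]: "?h \<in> borel_measurable (?\<upsilon> \<Otimes>\<^sub>M ?\<upsilon>)"
    and gi: "integrable (?\<xi> \<Otimes>\<^sub>M ?\<xi>) (\<lambda>z. (?g z)\<^sup>2)"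
    and hi: "integrable (?\<upsilon> \<Otimes>\<^sub>M ?\<upsilon>) (\<lambda>z. (?h z)\<^sup>2)"
    using X Y by (auto simp: gm_space_def Let_def case_prod_unfold)
  have dx: "distr (\<pi> \<Otimes>\<^sub>M \<pi>) (?\<xi> \<Otimes>\<^sub>M ?\<xi>) (\<lambda>(z, z'). (fst z, fst z')) = ?\<xi> \<Otimes>\<^sub>M ?\<xi>"
    using pair_measure_distr[OF m(1) m(1)] d(1) px
    by (simp add: prob_space_imp_sigma_finite)
  have dy: "distr (\<pi> \<Otimes>\<^sub>M \<pi>) (?\<upsilon> \<Otimes>\<^sub>M ?\<upsilon>) (\<lambda>(z, z'). (snd z, snd z')) = ?\<upsilon> \<Otimes>\<^sub>M ?\<upsilon>"
    using pair_measure_distr[OF m(2) m(2)] d(2) py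
    by (simp add: prob_space_imp_sigma_finite)
  have mx [measurable]: "(\<lambda>(z, z'). (fst z, fst z')) \<in> measurable (\<pi> \<Otimes>\<^sub>M \<pi>) (?\<xi> \<Otimes>\<^sub>M ?\<xi>)"
    by measurable
  have my [measurable]: "(\<lambda>(z, z'). (snd z, snd z')) \<in> measurable (\<pi> \<Otimes>\<^sub>M \<pi>) (?\<upsilon> \<Otimes>\<^sub>M ?\<upsilon>)"
    by measurable
  define G where "G z = ?g ((\<lambda>(z, z'). (fst z, fst z')) z)" for z :: "('a \<times> 'b) \<times> 'a \<times> 'b"
  define H where "H z = ?h ((\<lambda>(z, z'). (snd z, snd z')) z)" for z :: "('a \<times> 'b) \<times> 'a \<times> 'b"
  have mG [measurable]: "G \<in> borel_measurable (\<pi> \<Otimes>\<^sub>M \<pi>)"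
    unfolding G_def by (rule measurable_compose[OF mx g])
  have mH [measurable]: "H \<in> borel_measurable (\<pi> \<Otimes>\<^sub>M \<pi>)"
    unfolding H_def by (rule measurable_compose[OF my h])
  have iG: "integrable (\<pi> \<Otimes>\<^sub>M \<pi>) (\<lambda>z. (G z)\<^sup>2)"
    unfolding G_def by (rule integrable_distr[OF mx, of "\<lambda>z. (?g z)\<^sup>2"]) (simp only: dx gi)
  have iH: "integrable (\<pi> \<Otimes>\<^sub>M \<pi>) (\<lambda>z. (H z)\<^sup>2)"
    unfolding H_def by (rule integrable_distr[OF my, of "\<lambda>z. (?h z)\<^sup>2"]) (simp only: dy hi)
  have "integrable (\<pi> \<Otimes>\<^sub>M \<pi>) (\<lambda>z. (G z - H z)\<^sup>2)"
  proof (rule Bochner_Integration.integrable_bound)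
    show "integrable (\<pi> \<Otimes>\<^sub>M \<pi>) (\<lambda>z. 2 * (G z)\<^sup>2 + 2 * (H z)\<^sup>2)"
      using iG iH by auto
    have "(a - b)\<^sup>2 \<le> 2 * a\<^sup>2 + 2 * b\<^sup>2" for a b :: real
      using zero_le_power2[of "a + b"] by (simp add: power2_sum power2_diff)
    then show "AE z in \<pi> \<Otimes>\<^sub>M \<pi>. norm ((G z - H z)\<^sup>2) \<le> norm (2 * (G z)\<^sup>2 + 2 * (H z)\<^sup>2)"
      by (auto intro!: AE_I2)
  qed measurable
  then show ?thesis
    by (simp add: G_def H_def case_prod_unfold)
qed

end

theory Submission
  imports Defs
begin

text \<open>
  Write \<open>d\<close> for the dimension, \<open>g\<close> for the gauge of \<open>\<X>\<close> and \<open>\<xi>\<close> for its measure. Two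
  properties of \<open>g\<close> carry the proof: it is Lipschitz on the bounded set \<open>X\<close>, and it separates points in mean
  square,
  \<open>\<integral> (g(x, x') - g(z, x'))\<^sup>2 d\<xi>(x') \<ge> c * \<parallel>x - z\<parallel>\<^sup>2\<close> with \<open>c > 0\<close>.

  The first one gives the upper bound (\<open>quantization_upper\<close>): a grid divides \<open>X\<close> into at most \<open>n\<close>
  cells of diameter of order \<open>n powr (-1/d)\<close>, and collapsing each cell to a point changes \<open>g\<close> by no
  more than that order.

  For the lower bound (\<open>quantization_lower\<close>), fix a space \<open>\<Y>\<close> with \<open>n\<close> points and gauge \<open>h\<close>, and a
  coupling \<open>\<pi>\<close>. The cost is the mean over \<open>(x, i)\<close> of the squared \<open>L\<^sup>2(\<pi>)\<close>-distance between the
  sections \<open>g(x, \<cdot>)\<close> and \<open>h(i, \<cdot>)\<close>, so \<open>\<Y>\<close> acts as a quantizer with \<open>n\<close> points of the image of \<open>\<xi>\<close>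
  under \<open>x \<mapsto> g(x, \<cdot>)\<close>. Since this map does not contract distances by more than a constant factor,
  the points represented with an error below \<open>r\<close> lie in \<open>n\<close> balls with radius of order \<open>r\<close>. If \<open>r\<close> is a
  small multiple of \<open>n powr (-1/d)\<close>, these balls have small total Lebesgue measure, hence carry less
  than half of the mass of \<open>\<xi>\<close> by absolute continuity (\<open>absolutely_continuous_uniform\<close>), and the
  other half pays an error of order \<open>r\<close>.

  Separation for the squared distance (\<open>sq_dist_separates\<close>) reduces to the positive definiteness of the
  covariance of \<open>\<xi>\<close> (\<open>variance_inner_uniform\<close>), which holds because \<open>\<xi>\<close> charges no hyperplane. The
  distance itself follows by dividing by \<open>\<parallel>x - x'\<parallel> + \<parallel>z - x'\<parallel> \<le> 4 * R\<close>, where \<open>R\<close> bounds the norm on \<open>X\<close>.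
\<close>

section \<open>Uniform absolute continuity\<close>

text \<open>
  If the claim failed, there would be sets whose \<open>M\<close>-measures are summable and whose
  \<open>N\<close>-measures stay above \<open>e\<close>. By Borel-Cantelli their limes superior is \<open>M\<close>-null, hence
  \<open>N\<close>-null; but continuity from above of the finite measure \<open>N\<close> gives it mass at least \<open>e\<close>.
\<close>
lemma absolutely_continuous_uniform:
  fixes e :: real
  assumes "finite_measure N" and sets: "sets N = sets M" and ac: "absolutely_continuous M N"
    and e: "0 < e"
  obtains d :: real where "0 < d" "\<And>A. A \<in> sets M \<Longrightarrow> emeasure M A \<le> ennreal d \<Longrightarrow> measure N A < e"
proof -
  interpret N: finite_measure N by fact
  have "\<exists>d>0. \<forall>A\<in>sets M. emeasure M A \<le> ennreal d \<longrightarrow> measure N A < e"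
  proof (rule ccontr)
    assume contr: "\<not> ?thesis"
    have "\<exists>A\<in>sets M. emeasure M A \<le> ennreal ((1/2)^k) \<and> e \<le> measure N A" for k :: nat
    proof -
      have "0 < (1/2::real)^k" by simp
      then show ?thesis using contr by (meson not_le)
    qed
    then obtain A where A: "\<And>k. A k \<in> sets M" "\<And>k. emeasure M (A k) \<le> ennreal ((1/2)^k)"
        "\<And>k. e \<le> measure N (A k)"
      by metis
    have fin: "emeasure M (A k) < \<infinity>" for k
      using A(2)[of k] by (metis ennreal_less_top infinity_ennreal_def order_le_less_trans)
    have "summable (\<lambda>k. measure M (A k))"
    proof (rule summable_comparison_test')
      show "summable (\<lambda>k. (1/2::real)^k)" by simp
      show "norm (measure M (A k)) \<le> (1/2)^k" for k
        using A(2)[of k] by (simp add: measure_def enn2real_leI)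
    qed
    then have "limsup A \<in> null_sets M"
      using A(1) fin by (intro borel_cantelli_limsup1) auto
    then have null: "limsup A \<in> null_sets N"
      using ac by (auto simp: absolutely_continuous_def)
    define B where "B n = (\<Union>k\<in>{n..}. A k)" for n
    have Bsets: "B n \<in> sets N" for n
      unfolding B_def using A(1) sets by auto
    have "(\<lambda>n. measure N (B n)) \<longlonglongrightarrow> measure N (\<Inter>n. B n)"
      using Bsets by (intro N.finite_Lim_measure_decseq) (force simp: B_def decseq_def)+
    moreover have "(\<Inter>n. B n) = limsup A"
      by (simp add: limsup_INF_SUP B_def)
    moreover have "e \<le> measure N (B n)" for n
      using A(3)[of n] Bsets by (smt (verit) B_def N.finite_measure_mono UN_upper atLeast_iff order_refl)
    ultimately have "e \<le> measure N (limsup A)"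
      by (metis LIMSEQ_le_const)
    then show False
      using null e by (simp add: measure_eq_0_null_sets)
  qed
  then show thesis using that by blast
qed

section \<open>Nondegenerate second moments\<close>

text \<open>
  The measures below live on a subset \<open>X\<close> of Euclidean space, with \<open>space \<xi> = X\<close> and a sigma-algebra
  given by the trace topology. Instead of moving them to the ambient Borel sigma-algebra, the
  locale records that the inclusion of \<open>X\<close> is Borel measurable; this also lets bounds on \<open>X\<close>
  hold at every point of \<open>space \<xi>\<close> and not just almost everywhere.
\<close>
locale bounded_prob_space = prob_space \<xi> for \<xi> :: "'a::euclidean_space measure" +
  fixes R :: real
  assumes id_measurable [measurable]: "(\<lambda>x. x) \<in> borel_measurable \<xi>"
    and norm_less: "\<And>x. x \<in> space \<xi> \<Longrightarrow> norm x < R"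
begin

lemma R_pos: "0 < R"
proof -
  obtain x where "x \<in> space \<xi>" using not_empty by blast
  then show ?thesis using norm_less[of x] norm_ge_zero[of x] by linarith
qed

lemma integrable_bounded:
  fixes f :: "'a \<Rightarrow> real"
  assumes "f \<in> borel_measurable \<xi>" "\<And>x. x \<in> space \<xi> \<Longrightarrow> \<bar>f x\<bar> \<le> B"
  shows "integrable \<xi> f"
  using assms by (intro integrable_const_bound[where B=B]) auto

lemma abs_inner_le: "x \<in> space \<xi> \<Longrightarrow> \<bar>u \<bullet> x\<bar> \<le> norm u * R"
  by (meson Cauchy_Schwarz_ineq2 less_imp_le mult_left_mono norm_ge_zero norm_less order_trans)

lemma hyperplane_null:
  assumes ac: "absolutely_continuous lborel (distr \<xi> borel (\<lambda>x. x))" and u: "u \<noteq> 0"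
  shows "AE x in \<xi>. u \<bullet> x \<noteq> c"
proof -
  have "{x. u \<bullet> x = c} \<in> null_sets lborel"
    using negligible_hyperplane[of u c] u
    by (simp add: negligible_iff_null_sets null_sets_completion_iff)
  then have "{x. u \<bullet> x = c} \<in> null_sets (distr \<xi> borel (\<lambda>x. x))"
    using ac by (auto simp: absolutely_continuous_def)
  then have "AE x in distr \<xi> borel (\<lambda>x. x). x \<notin> {x. u \<bullet> x = c}"
    by (rule AE_not_in)
  then show ?thesis
    by (subst (asm) AE_distr_iff) auto
qed

text \<open>
  A vanishing integral would concentrate \<open>\<xi>\<close> on the hyperplane \<open>u \<bullet> x = c\<close>, which is Lebesgue null.
\<close>
lemma variance_inner_pos:
  assumes ac: "absolutely_continuous lborel (distr \<xi> borel (\<lambda>x. x))" and u: "u \<noteq> 0"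
  shows "0 < (\<integral>x. (u \<bullet> x - c)\<^sup>2 \<partial>\<xi>)"
proof -
  have int: "integrable \<xi> (\<lambda>x. (u \<bullet> x - c)\<^sup>2)"
  proof (rule integrable_bounded)
    show "\<bar>(u \<bullet> x - c)\<^sup>2\<bar> \<le> (norm u * R + \<bar>c\<bar>)\<^sup>2" if "x \<in> space \<xi>" for x
      using abs_inner_le[OF that, of u] by (simp flip: abs_le_square_iff)
  qed measurable
  have "(\<integral>x. (u \<bullet> x - c)\<^sup>2 \<partial>\<xi>) \<noteq> 0"
  proof
    assume "(\<integral>x. (u \<bullet> x - c)\<^sup>2 \<partial>\<xi>) = 0"
    then have "AE x in \<xi>. (u \<bullet> x - c)\<^sup>2 = 0"
      using int by (simp add: integral_nonneg_eq_0_iff_AE)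
    with hyperplane_null[OF ac u, of c] have "AE x in \<xi>. False"
      by eventually_elim auto
    then show False by simp
  qed
  then show ?thesis
    by (simp add: order_less_le)
qed

text \<open>
  The smallest value of \<open>\<integral> (u \<bullet> x - a)\<^sup>2 d\<xi>\<close> over \<open>a\<close> is the variance of \<open>x \<mapsto> u \<bullet> x\<close>. It is a
  positive continuous function of \<open>u\<close> on the compact unit sphere, hence bounded away from zero
  there, and homogeneity of degree two extends the bound to all \<open>u\<close>. In other words, the covariance
  matrix of \<open>\<xi>\<close> is positive definite.
\<close>
lemma variance_inner_uniform:
  assumes ac: "absolutely_continuous lborel (distr \<xi> borel (\<lambda>x. x))"
  obtains c :: real where "0 < c" "\<And>u a. c * (norm u)\<^sup>2 \<le> (\<integral>x. (u \<bullet> x - a)\<^sup>2 \<partial>\<xi>)"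
proof -
  define m where "m u = (\<integral>x. u \<bullet> x \<partial>\<xi>)" for u
  define q where "q u = (\<integral>x. (u \<bullet> x - m u)\<^sup>2 \<partial>\<xi>)" for u
  have int1: "integrable \<xi> (\<lambda>x. u \<bullet> x)" for u
    by (rule integrable_bounded[where B="norm u * R"]) (use abs_inner_le in auto)
  have int2: "integrable \<xi> (\<lambda>x. (u \<bullet> x)\<^sup>2)" for u
  proof (rule integrable_bounded)
    show "\<bar>(u \<bullet> x)\<^sup>2\<bar> \<le> (norm u * R)\<^sup>2" if "x \<in> space \<xi>" for x
      using abs_inner_le[OF that, of u] R_pos by (simp flip: abs_le_square_iff)
  qed measurable
  have expand: "(\<integral>x. (u \<bullet> x - a)\<^sup>2 \<partial>\<xi>) = (\<integral>x. (u \<bullet> x)\<^sup>2 \<partial>\<xi>) - 2 * a * m u + a\<^sup>2" for u a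
    using int1[of u] int2[of u] by (simp add: power2_diff m_def prob_space algebra_simps)
  have q_le: "q u \<le> (\<integral>x. (u \<bullet> x - a)\<^sup>2 \<partial>\<xi>)" for u a
    unfolding q_def expand
    using zero_le_power2[of "a - m u"] by (simp add: power2_eq_square algebra_simps)
  have conv: "(\<lambda>n. \<integral>x. (s n \<bullet> x) ^ k \<partial>\<xi>) \<longlonglongrightarrow> (\<integral>x. (u \<bullet> x) ^ k \<partial>\<xi>)"
    if s: "\<And>n. norm (s n) = 1" "s \<longlonglongrightarrow> u" for s u and k :: nat
  proof (rule integral_dominated_convergence[where w="\<lambda>_. R ^ k"])
    show "AE x in \<xi>. norm ((s n \<bullet> x) ^ k) \<le> R ^ k" for n
      using abs_inner_le[of _ "s n"] s(1)[of n]
      by (intro AE_I2) (auto simp: power_abs intro!: power_mono)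
    show "AE x in \<xi>. (\<lambda>n. (s n \<bullet> x) ^ k) \<longlonglongrightarrow> (u \<bullet> x) ^ k"
      using s(2) by (intro AE_I2 tendsto_intros)
  qed auto
  have "continuous_on (sphere 0 1) q"
    unfolding continuous_on_sequentially
  proof (intro allI ballI impI, elim conjE)
    fix s and u :: 'a
    assume u: "u \<in> sphere 0 1" and s: "\<forall>n. s n \<in> sphere 0 1" and lim: "s \<longlonglongrightarrow> u"
    then have n1: "norm (s n) = 1" for n by simp
    have "(\<lambda>n. m (s n)) \<longlonglongrightarrow> m u"
      using conv[OF n1 lim, of 1] by (simp add: m_def comp_def)
    then have "(\<lambda>n. (\<integral>x. (s n \<bullet> x)\<^sup>2 \<partial>\<xi>) - 2 * m (s n) * m (s n) + (m (s n))\<^sup>2)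
        \<longlonglongrightarrow> (\<integral>x. (u \<bullet> x)\<^sup>2 \<partial>\<xi>) - 2 * m u * m u + (m u)\<^sup>2"
      using conv[OF n1 lim, of 2] by (intro tendsto_intros) (auto simp: comp_def)
    then show "(q \<circ> s) \<longlonglongrightarrow> q u"
      by (simp add: q_def expand comp_def)
  qed
  moreover have "sphere (0::'a) 1 \<noteq> {}" by simp
  ultimately obtain v where v: "v \<in> sphere 0 1" "\<And>u. u \<in> sphere 0 1 \<Longrightarrow> q v \<le> q u"
    by (meson compact_sphere continuous_attains_inf)
  have scale: "q (t *\<^sub>R u) = t\<^sup>2 * q u" for t u
  proof -
    have "m (t *\<^sub>R u) = t * m u" by (simp add: m_def)
    then have "q (t *\<^sub>R u) = (\<integral>x. t\<^sup>2 * (u \<bullet> x - m u)\<^sup>2 \<partial>\<xi>)"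
      unfolding q_def by (simp add: power_mult_distrib flip: right_diff_distrib)
    then show ?thesis by (simp add: q_def)
  qed
  show thesis
  proof
    show "0 < q v"
      unfolding q_def using v(1) by (intro variance_inner_pos[OF ac]) auto
    fix u :: 'a and a
    have "q v * (norm u)\<^sup>2 \<le> q u"
    proof (cases "u = 0")
      case True
      then show ?thesis by (simp add: q_def)
    next
      case False
      then have "q v \<le> q (u /\<^sub>R norm u)"
        by (intro v(2)) auto
      then have "q v * (norm u)\<^sup>2 \<le> q (u /\<^sub>R norm u) * (norm u)\<^sup>2"
        by (rule mult_right_mono) simp
      also have "\<dots> = q u"
        using False by (simp add: scale power_inverse)
      finally show ?thesis .
    qed
    then show "q v * (norm u)\<^sup>2 \<le> (\<integral>x. (u \<bullet> x - a)\<^sup>2 \<partial>\<xi>)"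
      using q_le order_trans by blast
  qed
qed

end

section \<open>Grid partitions of a ball\<close>

text \<open>
  Cut each axis of the cube \<open>(-R, R)\<^sup>d\<close> into \<open>k = \<lfloor>n powr (1/d)\<rfloor>\<close> intervals. The resulting
  \<open>k ^ d \<le> n\<close> cells can be numbered by \<open>{1..n}\<close>, and two points of one cell differ by at most
  \<open>2 * R / k\<close> in each coordinate. The constant \<open>4\<close> comes from \<open>n powr (1/d) \<le> 2 * k\<close>.
\<close>
lemma grid_partition:
  fixes R :: real and n :: nat
  assumes R: "0 < R" and n: "1 \<le> n"
  obtains idx :: "'a::euclidean_space \<Rightarrow> nat"
  where "idx \<in> measurable borel (count_space {1..n})"
    "\<And>x z. norm x < R \<Longrightarrow> norm z < R \<Longrightarrow> idx x = idx z \<Longrightarrow>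
       norm (x - z) \<le> 4 * R * real DIM('a) * real n powr (- (1 / real DIM('a)))"
proof -
  define r where "r = real n powr (1 / real DIM('a))"
  define k where "k = nat \<lfloor>r\<rfloor>"
  have r1: "1 \<le> r" using n by (simp add: r_def ge_one_powr_ge_zero)
  have k: "1 \<le> k" "real k \<le> r" "r \<le> 2 * real k"
  proof -
    have "1 \<le> \<lfloor>r\<rfloor>" using r1 by simp
    then show "1 \<le> k" "real k \<le> r" "r \<le> 2 * real k"
      unfolding k_def using r1 by (simp_all, linarith+)
  qed
  have "r ^ DIM('a) = real n"
    using n by (simp add: r_def powr_powr flip: powr_realpow)
  then have "real k ^ DIM('a) \<le> real n"
    using power_mono[OF k(2), of "DIM('a)"] by simp
  then have kn: "k ^ DIM('a) \<le> n"
    by (metis of_nat_le_iff of_nat_power)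
  define P where "P = PiE (Basis::'a set) (\<lambda>_. {..<k})"
  define f where "f x b = nat \<lfloor>(x \<bullet> b + R) * (real k / (2 * R))\<rfloor>" for x b :: 'a
  have finP: "finite P" by (simp add: P_def finite_PiE)
  have "card P \<le> card {1..n}" using kn by (simp add: P_def card_PiE)
  then obtain e where e: "e ` P \<subseteq> {1..n}" "inj_on e P"
    using card_le_inj[OF finP, of "{1..n}"] by auto
  have range: "0 \<le> (x \<bullet> b + R) * (real k / (2 * R))" "(x \<bullet> b + R) * (real k / (2 * R)) < real k"
    if "norm x < R" "b \<in> Basis" for x b :: 'a
  proof -
    have *: "- R < x \<bullet> b" "x \<bullet> b < R" using Basis_le_norm[OF that(2), of x] that(1) by linarith+
    then show "0 \<le> (x \<bullet> b + R) * (real k / (2 * R))" using R by simp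
    have "(x \<bullet> b + R) * (real k / (2 * R)) < (2 * R) * (real k / (2 * R))"
      using * R k by (intro mult_strict_right_mono) auto
    then show "(x \<bullet> b + R) * (real k / (2 * R)) < real k" using R by simp
  qed
  have fP: "restrict (f x) Basis \<in> P" if "norm x < R" for x
    using range[OF that] by (auto simp: P_def f_def nat_less_iff floor_less_iff)
  define idx where "idx x = (if norm x < R then e (restrict (f x) Basis) else 1)" for x
  \<comment> \<open>Measurability: a level set of idx is a finite combination of level sets of the coordinates.\<close>
  have idx_eq: "idx x = a \<longleftrightarrow> (if norm x < R then \<exists>\<phi>\<in>P. e \<phi> = a \<and> (\<forall>b\<in>Basis. f x b = \<phi> b) else a = 1)"
    for x a
  proof -
    have "restrict (f x) Basis = \<phi> \<longleftrightarrow> (\<forall>b\<in>Basis. f x b = \<phi> b)" if "\<phi> \<in> P" for \<phi>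
      using that by (auto simp: P_def fun_eq_iff PiE_def extensional_def)
    then have "(\<exists>\<phi>\<in>P. e \<phi> = a \<and> (\<forall>b\<in>Basis. f x b = \<phi> b)) \<longleftrightarrow>
        (\<exists>\<phi>\<in>P. e \<phi> = a \<and> restrict (f x) Basis = \<phi>)"
      by blast
    then show ?thesis using fP[of x] by (simp add: idx_def) blast
  qed
  show thesis
  proof
    have [measurable]: "(\<lambda>x. f x b) \<in> measurable borel (count_space UNIV)" for b
      unfolding f_def by measurable
    have [measurable]: "finite (Basis::'a set)" by simp
    have "{x. idx x = a} \<in> sets borel" for a
      unfolding idx_eq using finP by measurable
    then have "idx -` {a} \<inter> space borel \<in> sets borel" for a
      by (simp add: vimage_def)
    moreover have "idx x \<in> {1..n}" for x
      using subsetD[OF e(1) imageI[OF fP[of x]]] n by (auto simp: idx_def)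
    ultimately show "idx \<in> measurable borel (count_space {1..n})"
      by (subst measurable_count_space_eq2) auto
    fix x z assume x: "norm x < R" and z: "norm z < R" and eq: "idx x = idx z"
    then have "restrict (f x) Basis = restrict (f z) Basis"
      using inj_onD[OF e(2) _ fP[OF x] fP[OF z]] by (simp add: idx_def)
    then have f_eq: "f x b = f z b" if "b \<in> Basis" for b
      using that by (metis restrict_apply')
    have "\<bar>(x - z) \<bullet> b\<bar> \<le> 2 * R / real k" if b: "b \<in> Basis" for b
    proof -
      have "\<lfloor>(x \<bullet> b + R) * (real k / (2 * R))\<rfloor> = \<lfloor>(z \<bullet> b + R) * (real k / (2 * R))\<rfloor>"
        using f_eq[OF b] range(1)[OF x b] range(1)[OF z b] by (simp add: f_def eq_nat_nat_iff)
      then have "\<bar>(x \<bullet> b + R) * (real k / (2 * R)) - (z \<bullet> b + R) * (real k / (2 * R))\<bar> \<le> 1"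
        by linarith
      also have "(x \<bullet> b + R) * (real k / (2 * R)) - (z \<bullet> b + R) * (real k / (2 * R))
          = ((x - z) \<bullet> b) * (real k / (2 * R))"
        by (simp only: left_diff_distrib[symmetric]) (simp add: inner_diff_left)
      finally show ?thesis
        using R k by (simp add: abs_mult field_simps)
    qed
    then have "norm (x - z) \<le> (\<Sum>b\<in>(Basis::'a set). 2 * R / real k)"
      by (rule order_trans[OF norm_le_l1 sum_mono])
    also have "\<dots> = 2 * R * real DIM('a) / real k" by simp
    also have "\<dots> \<le> 2 * R * real DIM('a) / (r / 2)"
      using R k r1 by (intro divide_left_mono) auto
    also have "\<dots> = 4 * R * real DIM('a) * real n powr (- (1 / real DIM('a)))"
      by (simp add: r_def powr_minus divide_simps)
    finally show "norm (x - z) \<le> 4 * R * real DIM('a) * real n powr (- (1 / real DIM('a)))" .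
  qed
qed

section \<open>Gauged measure spaces on Euclidean sets and on finite sets\<close>

lemma space_borel_sigma_top_of_set:
  fixes \<xi> :: "'a::topological_space measure"
  assumes "sets \<xi> = sets (borel_sigma (top_of_set S))"
  shows "space \<xi> = S" and "(\<lambda>x. x) \<in> borel_measurable \<xi>"
proof -
  have sub: "{U. openin (top_of_set S) U} \<subseteq> Pow S"
    by (auto simp: openin_open)
  have "space (borel_sigma (top_of_set S)) = S"
    unfolding borel_sigma_def using sub by (simp add: space_measure_of)
  then show sp: "space \<xi> = S"
    using sets_eq_imp_space_eq[OF assms] by simp
  show "(\<lambda>x. x) \<in> borel_measurable \<xi>"
  proof (rule borel_measurableI)
    fix U :: "'a set" assume "open U"
    then have "S \<inter> U \<in> sets (borel_sigma (top_of_set S))"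
      unfolding borel_sigma_def using sub by (auto simp: openin_open_Int)
    then show "(\<lambda>x. x) -` U \<inter> space \<xi> \<in> sets \<xi>"
      by (simp add: assms sp Int_commute)
  qed
qed

lemma sets_borel_sigma_discrete: "sets (borel_sigma (discrete_topology U)) = Pow U"
  by (simp add: borel_sigma_def sigma_algebra.sigma_sets_eq[OF sigma_algebra_Pow] flip: Pow_def)

lemma couplings_nonempty:
  assumes "gm_space \<X>" "gm_space \<Y>"
  shows "couplings (gm_measure \<X>) (gm_measure \<Y>) \<noteq> {}"
proof -
  have "prob_space (gm_measure \<X>)" "prob_space (gm_measure \<Y>)"
    using assms by (simp_all add: gm_space_def Let_def)
  then show ?thesis using pair_in_couplings by blast
qed

lemma GW2_le:
  assumes "\<pi> \<in> couplings (gm_measure \<X>) (gm_measure \<Y>)"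
  shows "GW2 \<X> \<Y> \<le> sqrt (\<integral>((x, y), (x', y')). \<bar>gauge \<X> x x' - gauge \<Y> y y'\<bar>\<^sup>2 \<partial>(\<pi> \<Otimes>\<^sub>M \<pi>))"
  unfolding GW2_def
  by (rule cINF_lower[OF _ assms]) (auto intro!: bdd_belowI[of _ 0] Bochner_Integration.integral_nonneg)

lemma GW2_nonneg:
  assumes "gm_space \<X>" "gm_space \<Y>"
  shows "0 \<le> GW2 \<X> \<Y>"
  unfolding GW2_def using couplings_nonempty[OF assms]
  by (intro cINF_greatest) (auto intro!: Bochner_Integration.integral_nonneg)

lemma q_GW_le:
  assumes "gm_space \<X>" "\<Y> \<in> GM n"
  shows "q_GW n \<X> \<le> GW2 \<X> \<Y>"
  unfolding q_GW_def using assms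
  by (intro cINF_lower) (auto intro!: bdd_belowI[of _ 0] GW2_nonneg simp: GM_def)

text \<open>
  On a finite discrete space every gauge is measurable and square integrable, so symmetry is the
  only condition to check.
\<close>
lemma finite_gm_space:
  fixes G :: "nat \<Rightarrow> nat \<Rightarrow> real"
  assumes "prob_space \<upsilon>" and sets: "sets \<upsilon> = Pow {1..n}"
    and sym: "\<And>i j. i \<in> {1..n} \<Longrightarrow> j \<in> {1..n} \<Longrightarrow> G i j = G j i"
  shows "\<lparr>gm_top = discrete_topology {1..n}, gauge = G, gm_measure = \<upsilon>\<rparr> \<in> GM n"
proof -
  interpret prob_space \<upsilon> by fact
  interpret P: pair_prob_space \<upsilon> \<upsilon> ..
  have sp: "space \<upsilon> = {1..n}"
    using sets_eq_imp_space_eq[of \<upsilon> "count_space {1..n}"] sets by simp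
  have sets2: "sets (\<upsilon> \<Otimes>\<^sub>M \<upsilon>) = sets (count_space ({1..n} \<times> {1..n}))"
    using sets_pair_countable[of "{1..n}" "{1..n}" \<upsilon> \<upsilon>] sets by simp
  have meas: "F \<in> borel_measurable (\<upsilon> \<Otimes>\<^sub>M \<upsilon>)" for F :: "nat \<times> nat \<Rightarrow> real"
    by (subst measurable_cong_sets[OF sets2 refl]) simp
  define B where "B = Max ((\<lambda>(i, j). (G i j)\<^sup>2) ` ({1..n} \<times> {1..n}))"
  have B: "(G i j)\<^sup>2 \<le> B" if "i \<in> {1..n}" "j \<in> {1..n}" for i j
    unfolding B_def using that by (intro Max_ge) (auto intro!: image_eqI[where x="(i, j)"])
  have "integrable (\<upsilon> \<Otimes>\<^sub>M \<upsilon>) (\<lambda>(i, j). (G i j)\<^sup>2)"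
    by (rule P.P.integrable_const_bound[where B=B])
      (use B in \<open>auto intro!: AE_I2 meas simp: space_pair_measure sp\<close>)
  moreover have "AE (i, j) in \<upsilon> \<Otimes>\<^sub>M \<upsilon>. G i j = G j i"
    using sym by (auto intro!: AE_I2 simp: space_pair_measure sp)
  moreover have "polish_topology (discrete_topology {1..n})"
    by (simp add: polish_topology_def completely_metrizable_space_discrete_topology
        separable_space_discrete_topology)
  ultimately show ?thesis
    using sym assms(1) by (auto simp: GM_def gm_space_def sets_borel_sigma_discrete sets meas)
qed

lemma GM_measure:
  assumes "\<Y> \<in> GM n"
  shows "sets (gm_measure \<Y>) = Pow {1..n}" and "space (gm_measure \<Y>) = {1..n}"
proof -
  show *: "sets (gm_measure \<Y>) = Pow {1..n}"
    using assms by (auto simp: GM_def gm_space_def Let_def sets_borel_sigma_discrete)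
  show "space (gm_measure \<Y>) = {1..n}"
    using sets_eq_imp_space_eq[of "gm_measure \<Y>" "count_space {1..n}"] * by simp
qed

lemma GM_nonempty:
  assumes "1 \<le> n" shows "GM n \<noteq> {}"
proof -
  have "prob_space (return (count_space {1..n}) (1::nat))"
    using assms by (intro prob_space_return) simp
  from finite_gm_space[OF this, of n "\<lambda>_ _. 0"] show ?thesis by auto
qed

section \<open>Upper bound for Lipschitz gauges\<close>

text \<open>
  Collapse every cell of a grid partition to one of its points: transport \<open>\<xi>\<close> by the cell number
  \<open>idx\<close> and give the cells the gauge values of their representatives \<open>p i\<close>. Under the coupling
  induced by \<open>x \<mapsto> (x, idx x)\<close> the two gauges differ pointwise by at most \<open>2 * L\<close> times the diameter
  of a cell.
\<close>
lemma quantization_upper: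
  fixes \<X> :: "'a::euclidean_space gm"
  assumes X: "gm_space \<X>" and "bounded_prob_space (gm_measure \<X>) R"
    and n: "1 \<le> n" and L: "0 \<le> L"
    and sym: "\<And>x x'. x \<in> space (gm_measure \<X>) \<Longrightarrow> x' \<in> space (gm_measure \<X>) \<Longrightarrow> gauge \<X> x x' = gauge \<X> x' x"
    and lip: "\<And>x x' z z'. x \<in> space (gm_measure \<X>) \<Longrightarrow> x' \<in> space (gm_measure \<X>) \<Longrightarrow>
       z \<in> space (gm_measure \<X>) \<Longrightarrow> z' \<in> space (gm_measure \<X>) \<Longrightarrow>
       \<bar>gauge \<X> x x' - gauge \<X> z z'\<bar> \<le> L * (norm (x - z) + norm (x' - z'))"
  shows "q_GW n \<X> \<le> 8 * L * R * real DIM('a) * real n powr (- (1 / real DIM('a)))"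
proof -
  define \<xi> where "\<xi> = gm_measure \<X>"
  interpret bounded_prob_space \<xi> R using assms(2) by (simp add: \<xi>_def)
  define \<Delta> where "\<Delta> = 4 * R * real DIM('a) * real n powr (- (1 / real DIM('a)))"
  obtain idx :: "'a \<Rightarrow> nat" where idx: "idx \<in> measurable borel (count_space {1..n})"
    and close: "\<And>x z. norm x < R \<Longrightarrow> norm z < R \<Longrightarrow> idx x = idx z \<Longrightarrow> norm (x - z) \<le> \<Delta>"
    using grid_partition[OF R_pos n] unfolding \<Delta>_def by blast
  have idx_meas [measurable]: "idx \<in> measurable \<xi> (count_space {1..n})"
    using measurable_compose[OF id_measurable idx] .
  \<comment> \<open>Empty cells carry no mass; the arbitrary point x0 only makes their gauge values well defined.\<close>
  obtain x0 where x0: "x0 \<in> space \<xi>" using not_empty by blast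
  define p where "p i = (if i \<in> idx ` space \<xi> then inv_into (space \<xi>) idx i else x0)" for i
  have p_space: "p i \<in> space \<xi>" for i
    using x0 by (auto simp: p_def inv_into_into)
  have p_close: "norm (x - p (idx x)) \<le> \<Delta>" if "x \<in> space \<xi>" for x
    using that p_space[of "idx x"] by (intro close norm_less) (auto simp: p_def f_inv_into_f)
  define \<upsilon> where "\<upsilon> = distr \<xi> (count_space {1..n}) idx"
  define G where "G i j = gauge \<X> (p i) (p j)" for i j
  define \<Y> where "\<Y> = \<lparr>gm_top = discrete_topology {1..n}, gauge = G, gm_measure = \<upsilon>\<rparr>"
  have prob_v: "prob_space \<upsilon>" unfolding \<upsilon>_def by (rule prob_space_distr) measurable
  have Y: "\<Y> \<in> GM n"
    unfolding \<Y>_def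
    by (rule finite_gm_space[OF prob_v]) (auto simp: \<upsilon>_def G_def intro!: sym p_space[unfolded \<xi>_def])
  define h where "h x = (x, idx x)" for x
  have h: "h \<in> measurable \<xi> (\<xi> \<Otimes>\<^sub>M \<upsilon>)"
    unfolding h_def \<upsilon>_def by measurable
  define \<pi> where "\<pi> = distr \<xi> (\<xi> \<Otimes>\<^sub>M \<upsilon>) h"
  have "distr \<pi> \<xi> fst = \<xi>"
    unfolding \<pi>_def by (subst distr_distr[OF _ h]) (auto simp: comp_def h_def distr_id)
  moreover have "distr \<pi> \<upsilon> snd = \<upsilon>"
    unfolding \<pi>_def by (subst distr_distr[OF _ h]) (auto simp: comp_def h_def \<upsilon>_def intro!: distr_cong)
  ultimately have \<pi>: "\<pi> \<in> couplings (gm_measure \<X>) (gm_measure \<Y>)"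
    by (simp add: couplings_def \<Y>_def \<pi>_def flip: \<xi>_def)
  define c where "c = (\<lambda>((x, y), (x', y')). \<bar>gauge \<X> x x' - gauge \<Y> y y'\<bar>\<^sup>2)"
  have int: "integrable (\<pi> \<Otimes>\<^sub>M \<pi>) c"
    using GW2_integrable[OF X _ \<pi>] Y by (simp add: c_def GM_def)
  interpret P: pair_prob_space \<xi> \<xi> ..
  define hh where "hh = (\<lambda>(x, x'). (h x, h x'))"
  have hh: "hh \<in> measurable (\<xi> \<Otimes>\<^sub>M \<xi>) ((\<xi> \<Otimes>\<^sub>M \<upsilon>) \<Otimes>\<^sub>M (\<xi> \<Otimes>\<^sub>M \<upsilon>))"
    unfolding hh_def using h by measurable
  have \<pi>\<pi>: "\<pi> \<Otimes>\<^sub>M \<pi> = distr (\<xi> \<Otimes>\<^sub>M \<xi>) ((\<xi> \<Otimes>\<^sub>M \<upsilon>) \<Otimes>\<^sub>M (\<xi> \<Otimes>\<^sub>M \<upsilon>)) hh"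
    unfolding \<pi>_def hh_def
    by (rule pair_measure_distr[OF h h]) (rule prob_space_imp_sigma_finite[OF prob_space_distr[OF h]])
  have cm: "c \<in> borel_measurable ((\<xi> \<Otimes>\<^sub>M \<upsilon>) \<Otimes>\<^sub>M (\<xi> \<Otimes>\<^sub>M \<upsilon>))"
    using borel_measurable_integrable[OF int] by (simp add: \<pi>\<pi>)
  have "integral\<^sup>L (\<pi> \<Otimes>\<^sub>M \<pi>) c = (\<integral>z. c (hh z) \<partial>(\<xi> \<Otimes>\<^sub>M \<xi>))"
    unfolding \<pi>\<pi> by (rule integral_distr[OF hh cm])
  also have "\<dots> \<le> (2 * L * \<Delta>)\<^sup>2"
  proof (rule P.P.integral_le_const)
    show "integrable (\<xi> \<Otimes>\<^sub>M \<xi>) (\<lambda>z. c (hh z))"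
      using int unfolding \<pi>\<pi> by (rule integrable_distr[OF hh])
    have "\<bar>gauge \<X> x x' - G (idx x) (idx x')\<bar>\<^sup>2 \<le> (2 * L * \<Delta>)\<^sup>2"
      if x: "x \<in> space \<xi>" "x' \<in> space \<xi>" for x x'
    proof (rule power_mono)
      have "\<bar>gauge \<X> x x' - G (idx x) (idx x')\<bar> \<le> L * (norm (x - p (idx x)) + norm (x' - p (idx x')))"
        unfolding G_def using x p_space by (intro lip) (auto simp: \<xi>_def)
      also have "\<dots> \<le> L * (\<Delta> + \<Delta>)"
        using p_close x L by (intro mult_left_mono add_mono) auto
      finally show "\<bar>gauge \<X> x x' - G (idx x) (idx x')\<bar> \<le> 2 * L * \<Delta>" by simp
    qed simp
    then show "AE z in \<xi> \<Otimes>\<^sub>M \<xi>. c (hh z) \<le> (2 * L * \<Delta>)\<^sup>2"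
      by (intro AE_I2) (auto simp: c_def hh_def h_def \<Y>_def space_pair_measure)
  qed
  finally have "sqrt (integral\<^sup>L (\<pi> \<Otimes>\<^sub>M \<pi>) c) \<le> 2 * L * \<Delta>"
    using L R_pos by (intro real_le_lsqrt) (auto simp: \<Delta>_def)
  then have "q_GW n \<X> \<le> 2 * L * \<Delta>"
    using GW2_le[OF \<pi>] q_GW_le[OF X Y] unfolding c_def by linarith
  then show ?thesis by (simp add: \<Delta>_def mult_ac)
qed

section \<open>Lower bound for gauges that separate points in mean square\<close>

text \<open>
  Integrability on the product only gives integrability of almost every section. The argument below
  compares sections at arbitrary points, so here the boundedness of both gauges is used.
\<close>
lemma section_integrable:
  fixes B :: real
  assumes X: "gm_space \<X>" and Y: "\<Y> \<in> GM n"
    and \<pi>: "\<pi> \<in> couplings (gm_measure \<X>) (gm_measure \<Y>)"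
    and B: "\<And>x x'. x \<in> space (gm_measure \<X>) \<Longrightarrow> x' \<in> space (gm_measure \<X>) \<Longrightarrow> \<bar>gauge \<X> x x'\<bar> \<le> B"
    and x: "x \<in> space (gm_measure \<X>)"
  shows "integrable \<pi> (\<lambda>(x', y'). \<bar>gauge \<X> x x' - gauge \<Y> i y'\<bar>\<^sup>2)"
proof -
  let ?\<xi> = "gm_measure \<X>" and ?\<upsilon> = "gm_measure \<Y>"
  interpret \<pi>: prob_space \<pi>
    using X \<pi> by (auto intro: couplings_prob_space simp: gm_space_def Let_def)
  have s: "sets \<pi> = sets (?\<xi> \<Otimes>\<^sub>M ?\<upsilon>)" using \<pi> by (auto simp: couplings_def)
  have sp: "space \<pi> = space ?\<xi> \<times> {1..n}"
    using sets_eq_imp_space_eq[OF s] by (simp add: space_pair_measure GM_measure[OF Y])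
  have m [measurable]: "fst \<in> measurable \<pi> ?\<xi>" "snd \<in> measurable \<pi> ?\<upsilon>"
    using s by (simp_all cong: measurable_cong_sets)
  have "(\<lambda>(x, x'). gauge \<X> x x') \<in> borel_measurable (?\<xi> \<Otimes>\<^sub>M ?\<xi>)"
    using X by (simp add: gm_space_def Let_def)
  from measurable_Pair2[OF this x] have [measurable]: "gauge \<X> x \<in> borel_measurable ?\<xi>"
    by simp
  have discrete: "sets ?\<upsilon> = sets (count_space {1..n})" by (simp add: GM_measure[OF Y])
  have [measurable]: "gauge \<Y> i \<in> borel_measurable ?\<upsilon>"
    unfolding measurable_cong_sets[OF discrete refl] by simp
  define H where "H = Max ((\<lambda>j. \<bar>gauge \<Y> i j\<bar>) ` {1..n})"
  have H: "\<bar>gauge \<Y> i j\<bar> \<le> H" if "j \<in> {1..n}" for j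
    unfolding H_def using that by (intro Max_ge) auto
  show ?thesis
  proof (rule \<pi>.integrable_const_bound)
    have "\<bar>gauge \<X> x (fst w) - gauge \<Y> i (snd w)\<bar>\<^sup>2 \<le> (B + H)\<^sup>2" if "w \<in> space \<pi>" for w
    proof (rule power_mono)
      have "fst w \<in> space ?\<xi>" "snd w \<in> {1..n}" using that by (auto simp: sp)
      then show "\<bar>gauge \<X> x (fst w) - gauge \<Y> i (snd w)\<bar> \<le> B + H"
        using B[OF x] H by (smt (verit))
    qed simp
    then show "AE w in \<pi>. norm (case w of (x', y') \<Rightarrow> \<bar>gauge \<X> x x' - gauge \<Y> i y'\<bar>\<^sup>2) \<le> (B + H)\<^sup>2"
      by (intro AE_I2) (simp add: case_prod_unfold)
  qed (simp add: case_prod_unfold)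
qed

text \<open>
  The left-hand side depends on the first coordinate only, so it is an integral against \<open>\<pi>\<close>.
  Viewing \<open>x\<close> and \<open>z\<close> as the points \<open>g(x, \<cdot>)\<close> and \<open>g(z, \<cdot>)\<close> of \<open>L\<^sup>2(\<pi>)\<close>, it is a triangle inequality
  through the point \<open>h(i, \<cdot>)\<close>: two points that the index \<open>i\<close> represents well have sections close to
  each other.
\<close>
lemma section_triangle:
  fixes B :: real
  assumes X: "gm_space \<X>" and Y: "\<Y> \<in> GM n"
    and \<pi>: "\<pi> \<in> couplings (gm_measure \<X>) (gm_measure \<Y>)"
    and B: "\<And>x x'. x \<in> space (gm_measure \<X>) \<Longrightarrow> x' \<in> space (gm_measure \<X>) \<Longrightarrow> \<bar>gauge \<X> x x'\<bar> \<le> B"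
    and x: "x \<in> space (gm_measure \<X>)" and z: "z \<in> space (gm_measure \<X>)"
  shows "(\<integral>x'. (gauge \<X> x x' - gauge \<X> z x')\<^sup>2 \<partial>gm_measure \<X>) \<le>
    2 * (\<integral>(x', y'). \<bar>gauge \<X> x x' - gauge \<Y> i y'\<bar>\<^sup>2 \<partial>\<pi>) +
    2 * (\<integral>(x', y'). \<bar>gauge \<X> z x' - gauge \<Y> i y'\<bar>\<^sup>2 \<partial>\<pi>)"
proof -
  let ?\<xi> = "gm_measure \<X>"
  have s: "sets \<pi> = sets (?\<xi> \<Otimes>\<^sub>M gm_measure \<Y>)" and d: "distr \<pi> ?\<xi> fst = ?\<xi>"
    using \<pi> by (auto simp: couplings_def)
  have m [measurable]: "fst \<in> measurable \<pi> ?\<xi>"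
    using s by (simp cong: measurable_cong_sets)
  have g: "(\<lambda>(x, x'). gauge \<X> x x') \<in> borel_measurable (?\<xi> \<Otimes>\<^sub>M ?\<xi>)"
    using X by (simp add: gm_space_def Let_def)
  have [measurable]: "gauge \<X> x \<in> borel_measurable ?\<xi>" "gauge \<X> z \<in> borel_measurable ?\<xi>"
    using measurable_Pair2[OF g x] measurable_Pair2[OF g z] by simp_all
  have int: "integrable \<pi> (\<lambda>(x', y'). \<bar>gauge \<X> x x' - gauge \<Y> i y'\<bar>\<^sup>2)"
    "integrable \<pi> (\<lambda>(x', y'). \<bar>gauge \<X> z x' - gauge \<Y> i y'\<bar>\<^sup>2)"
    using section_integrable[OF X Y \<pi> B] x z by auto
  have "(\<integral>x'. (gauge \<X> x x' - gauge \<X> z x')\<^sup>2 \<partial>?\<xi>)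
      = (\<integral>w. (gauge \<X> x (fst w) - gauge \<X> z (fst w))\<^sup>2 \<partial>\<pi>)"
    by (subst d[symmetric], rule integral_distr) measurable
  also have "\<dots> \<le> (\<integral>w. 2 * (case w of (x', y') \<Rightarrow> \<bar>gauge \<X> x x' - gauge \<Y> i y'\<bar>\<^sup>2) +
      2 * (case w of (x', y') \<Rightarrow> \<bar>gauge \<X> z x' - gauge \<Y> i y'\<bar>\<^sup>2) \<partial>\<pi>)"
  proof (rule integral_mono')
    have "(a - b)\<^sup>2 \<le> 2 * \<bar>a - t\<bar>\<^sup>2 + 2 * \<bar>b - t\<bar>\<^sup>2" for a b t :: real
      using zero_le_power2[of "a + b - 2 * t"] by (simp add: power2_eq_square algebra_simps)
    then show "(gauge \<X> x (fst w) - gauge \<X> z (fst w))\<^sup>2 \<le>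
        2 * (case w of (x', y') \<Rightarrow> \<bar>gauge \<X> x x' - gauge \<Y> i y'\<bar>\<^sup>2) +
        2 * (case w of (x', y') \<Rightarrow> \<bar>gauge \<X> z x' - gauge \<Y> i y'\<bar>\<^sup>2)" for w
      by (simp add: case_prod_unfold)
  qed (use int in \<open>auto intro!: Bochner_Integration.integrable_add integrable_mult_right\<close>)
  also have "\<dots> = 2 * (\<integral>(x', y'). \<bar>gauge \<X> x x' - gauge \<Y> i y'\<bar>\<^sup>2 \<partial>\<pi>) +
    2 * (\<integral>(x', y'). \<bar>gauge \<X> z x' - gauge \<Y> i y'\<bar>\<^sup>2 \<partial>\<pi>)"
    using int by (subst Bochner_Integration.integral_add) auto
  finally show ?thesis .
qed

lemma emeasure_lborel_union_cballs:
  fixes a :: "nat \<Rightarrow> 'a::euclidean_space"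
  assumes "0 \<le> r"
  shows "emeasure lborel (\<Union>i\<in>{1..n}. cball (a i) r)
    \<le> ennreal (real n * (unit_ball_vol (real DIM('a)) * r ^ DIM('a)))"
proof -
  have "emeasure lborel (\<Union>i\<in>{1..n}. cball (a i) r) \<le> (\<Sum>i\<in>{1..n}. emeasure lborel (cball (a i) r))"
    by (rule emeasure_subadditive_finite) auto
  also have "\<dots> = ennreal (real n * (unit_ball_vol (real DIM('a)) * r ^ DIM('a)))"
    using assms by (simp add: emeasure_cball ennreal_mult ennreal_of_nat_eq_real_of_nat)
  finally show ?thesis .
qed

text \<open>
  Integrating in \<open>(x', y')\<close> first writes the cost as the mean of \<open>D x i\<close>, the squared distance in
  \<open>L\<^sup>2(\<pi>)\<close> between the sections \<open>g(x, \<cdot>)\<close> and \<open>h(i, \<cdot>)\<close>. By the separation hypothesis, the points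
  that \<open>i\<close> represents with \<open>D x i < c / 4 * r\<^sup>2\<close> are within distance \<open>r\<close> of each other and hence lie
  in one ball of that radius. So all well represented points lie in \<open>n\<close> balls of radius \<open>r\<close>, which carry less
  than half of the mass, and the other half pays at least \<open>c / 4 * r\<^sup>2\<close>.
\<close>
lemma coupling_cost_lower:
  fixes \<X> :: "'a::euclidean_space gm"
  assumes X: "gm_space \<X>" and bdd: "bounded_prob_space (gm_measure \<X>) R"
    and B: "\<And>x x'. x \<in> space (gm_measure \<X>) \<Longrightarrow> x' \<in> space (gm_measure \<X>) \<Longrightarrow> \<bar>gauge \<X> x x'\<bar> \<le> B"
    and c: "0 < c" and sep: "\<And>x z. x \<in> space (gm_measure \<X>) \<Longrightarrow> z \<in> space (gm_measure \<X>) \<Longrightarrow>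
      c * (norm (x - z))\<^sup>2 \<le> (\<integral>x'. (gauge \<X> x x' - gauge \<X> z x')\<^sup>2 \<partial>gm_measure \<X>)"
    and r: "0 < r"
    and small: "\<And>a :: nat \<Rightarrow> 'a.
      measure (distr (gm_measure \<X>) borel (\<lambda>x. x)) (\<Union>i\<in>{1..n}. cball (a i) r) < 1 / 2"
    and Y: "\<Y> \<in> GM n" and \<pi>: "\<pi> \<in> couplings (gm_measure \<X>) (gm_measure \<Y>)"
  shows "c / 8 * r\<^sup>2 \<le> (\<integral>((x, y), (x', y')). \<bar>gauge \<X> x x' - gauge \<Y> y y'\<bar>\<^sup>2 \<partial>(\<pi> \<Otimes>\<^sub>M \<pi>))"
proof -
  define \<xi> where "\<xi> = gm_measure \<X>"
  interpret bounded_prob_space \<xi> R using bdd by (simp add: \<xi>_def)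
  interpret \<pi>: prob_space \<pi>
    using couplings_prob_space[OF _ \<pi>] prob_space_axioms by (simp add: \<xi>_def)
  interpret P: pair_prob_space \<pi> \<pi> ..
  have s: "sets \<pi> = sets (\<xi> \<Otimes>\<^sub>M gm_measure \<Y>)" and d: "distr \<pi> \<xi> fst = \<xi>"
    using \<pi> by (auto simp: couplings_def \<xi>_def)
  have m [measurable]: "fst \<in> measurable \<pi> \<xi>"
    using s by (simp cong: measurable_cong_sets)
  have sp: "space \<pi> = space \<xi> \<times> {1..n}"
    using sets_eq_imp_space_eq[OF s] by (simp add: space_pair_measure GM_measure[OF Y])
  define D where "D x i = (\<integral>(x', y'). \<bar>gauge \<X> x x' - gauge \<Y> i y'\<bar>\<^sup>2 \<partial>\<pi>)" for x i
  define S where "S i = {x \<in> space \<xi>. D x i < c / 4 * r\<^sup>2}" for i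
  \<comment> \<open>Where S i is empty, the choice is arbitrary and the ball around it covers S i trivially.\<close>
  define a where "a i = (SOME x. x \<in> S i)" for i
  define A where "A = (\<Union>i\<in>{1..n}. cball (a i) r)"
  have A [measurable]: "A \<in> sets borel" unfolding A_def by auto
  have S_ball: "S i \<subseteq> cball (a i) r" for i
  proof
    fix x assume x: "x \<in> S i"
    then have "a i \<in> S i" unfolding a_def by (rule someI)
    with x have xa: "x \<in> space \<xi>" "a i \<in> space \<xi>" "D x i < c / 4 * r\<^sup>2" "D (a i) i < c / 4 * r\<^sup>2"
      by (auto simp: S_def)
    have "c * (norm (a i - x))\<^sup>2 \<le> 2 * D (a i) i + 2 * D x i"
      using sep[of "a i" x] section_triangle[OF X Y \<pi> B, of "a i" x i] xa
      unfolding D_def \<xi>_def by linarith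
    also have "\<dots> < c * r\<^sup>2" using xa by linarith
    finally have "(norm (a i - x))\<^sup>2 < r\<^sup>2" using c by simp
    then show "x \<in> cball (a i) r"
      using r by (simp add: dist_norm power2_less_imp_less less_imp_le)
  qed
  have D_ge: "c / 4 * r\<^sup>2 \<le> D x i" if "x \<in> space \<xi>" "x \<notin> A" "i \<in> {1..n}" for x i
    using that S_ball[of i] unfolding A_def S_def by force
  have D_nonneg: "0 \<le> D x i" for x i
    unfolding D_def by (auto intro!: Bochner_Integration.integral_nonneg)
  define f where "f = (\<lambda>((x, y), (x', y')). \<bar>gauge \<X> x x' - gauge \<Y> y y'\<bar>\<^sup>2)"
  have int: "integrable (\<pi> \<Otimes>\<^sub>M \<pi>) f"
    using GW2_integrable[OF X _ \<pi>] Y by (simp add: GM_def f_def)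
  have sect: "(\<integral>w'. f (w, w') \<partial>\<pi>) = D (fst w) (snd w)" for w
    by (simp add: D_def f_def case_prod_unfold)
  have Dint: "integrable \<pi> (\<lambda>w. D (fst w) (snd w))"
    using P.integrable_fst'[OF int] unfolding sect .
  have cost: "integral\<^sup>L (\<pi> \<Otimes>\<^sub>M \<pi>) f = (\<integral>w. D (fst w) (snd w) \<partial>\<pi>)"
    using P.integral_fst'[OF int] unfolding sect by simp
  define F where "F = {w \<in> space \<pi>. fst w \<notin> A}"
  have [measurable]: "(\<lambda>w. fst w) \<in> borel_measurable \<pi>"
    using measurable_compose[OF m id_measurable] .
  have F [measurable]: "F \<in> sets \<pi>" unfolding F_def by measurable
  have "measure \<pi> {w \<in> space \<pi>. fst w \<in> A} = measure (distr (distr \<pi> \<xi> fst) borel (\<lambda>x. x)) A"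
    by (subst distr_distr) (auto simp: measure_distr comp_def vimage_def intro!: arg_cong[where f="measure \<pi>"])
  also have "\<dots> < 1 / 2" using small[of a] unfolding d A_def by (simp add: \<xi>_def)
  finally have "1 / 2 \<le> measure \<pi> F"
    unfolding F_def by (subst \<pi>.prob_neg) auto
  then have "c / 4 * r\<^sup>2 * (1 / 2) \<le> c / 4 * r\<^sup>2 * measure \<pi> F"
    using c by (intro mult_left_mono) auto
  also have "\<dots> = (\<integral>w. c / 4 * r\<^sup>2 * indicator F w \<partial>\<pi>)"
    using sets.sets_into_space[OF F] by (simp add: Int_absorb2)
  also have "\<dots> \<le> (\<integral>w. D (fst w) (snd w) \<partial>\<pi>)"
  proof (rule integral_mono)
    show "integrable \<pi> (\<lambda>w. c / 4 * r\<^sup>2 * indicator F w)"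
      by (intro integrable_mult_right integrable_real_indicator) (auto simp: less_top[symmetric])
    show "c / 4 * r\<^sup>2 * indicator F w \<le> D (fst w) (snd w)" if "w \<in> space \<pi>" for w
      using that D_nonneg[of "fst w" "snd w"] D_ge[of "fst w" "snd w"]
      by (auto simp: F_def sp indicator_def)
  qed (rule Dint)
  finally show ?thesis unfolding f_def[symmetric] cost by simp
qed

text \<open>
  The radius \<open>r\<close> is chosen of order \<open>n powr (-1/d)\<close>, such that the total Lebesgue measure
  \<open>n * V * r ^ d\<close> of \<open>n\<close> balls is the constant \<open>\<delta>\<close> below which every set has \<open>\<xi>\<close>-measure less
  than one half; here \<open>V\<close> is the volume of the unit ball.
\<close>
lemma quantization_lower:
  fixes \<X> :: "'a::euclidean_space gm"
  assumes X: "gm_space \<X>" and bdd: "bounded_prob_space (gm_measure \<X>) R"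
    and ac: "absolutely_continuous lborel (distr (gm_measure \<X>) borel (\<lambda>x. x))"
    and B: "\<And>x x'. x \<in> space (gm_measure \<X>) \<Longrightarrow> x' \<in> space (gm_measure \<X>) \<Longrightarrow> \<bar>gauge \<X> x x'\<bar> \<le> B"
    and c: "0 < c" and sep: "\<And>x z. x \<in> space (gm_measure \<X>) \<Longrightarrow> z \<in> space (gm_measure \<X>) \<Longrightarrow>
      c * (norm (x - z))\<^sup>2 \<le> (\<integral>x'. (gauge \<X> x x' - gauge \<X> z x')\<^sup>2 \<partial>gm_measure \<X>)"
  obtains \<kappa> :: real where "0 < \<kappa>"
    "\<And>n. 1 \<le> n \<Longrightarrow> \<kappa> * real n powr (- (1 / real DIM('a))) \<le> q_GW n \<X>"
proof -
  define \<xi> where "\<xi> = gm_measure \<X>"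
  interpret bounded_prob_space \<xi> R using bdd by (simp add: \<xi>_def)
  define N where "N = distr \<xi> borel (\<lambda>x. x)"
  interpret N: prob_space N unfolding N_def by (rule prob_space_distr) measurable
  obtain \<delta> :: real where \<delta>: "0 < \<delta>"
    "\<And>A. A \<in> sets lborel \<Longrightarrow> emeasure lborel A \<le> ennreal \<delta> \<Longrightarrow> measure N A < 1 / 2"
    using absolutely_continuous_uniform[of N lborel "1/2"] ac N.finite_measure_axioms
    by (auto simp: N_def \<xi>_def)
  define V where "V = unit_ball_vol (real DIM('a))"
  have V: "0 < V" by (simp add: V_def)
  define \<rho> where "\<rho> = (\<delta> / V) powr (1 / real DIM('a))"
  have \<rho>: "0 < \<rho>" "\<rho> ^ DIM('a) = \<delta> / V"
    using \<delta>(1) V by (simp_all add: \<rho>_def powr_powr flip: powr_realpow)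
  show thesis
  proof
    show "0 < sqrt (c / 8) * \<rho>" using c \<rho> by simp
    fix n :: nat assume n: "1 \<le> n"
    define r where "r = \<rho> * real n powr (- (1 / real DIM('a)))"
    have r: "0 < r" using \<rho> n by (simp add: r_def)
    have "(real n powr (- (1 / real DIM('a)))) ^ DIM('a) = real n powr (- 1)"
      using n by (simp add: powr_powr flip: powr_realpow)
    also have "\<dots> = 1 / real n" by (simp add: powr_minus_divide)
    finally have "(real n powr (- (1 / real DIM('a)))) ^ DIM('a) = 1 / real n" .
    then have vol: "real n * (V * r ^ DIM('a)) = \<delta>"
      using n V by (simp add: r_def power_mult_distrib \<rho>)
    have small: "measure (distr (gm_measure \<X>) borel (\<lambda>x. x)) (\<Union>i\<in>{1..n}. cball (a i) r) < 1 / 2"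
      for a :: "nat \<Rightarrow> 'a"
      using \<delta>(2)[of "\<Union>i\<in>{1..n}. cball (a i) r"] emeasure_lborel_union_cballs[of r a n] r vol
      by (auto simp: N_def \<xi>_def V_def)
    have "sqrt (c / 8) * r \<le> GW2 \<X> \<Y>" if Y: "\<Y> \<in> GM n" for \<Y>
      unfolding GW2_def
    proof (rule cINF_greatest)
      show "couplings (gm_measure \<X>) (gm_measure \<Y>) \<noteq> {}"
        using X Y by (intro couplings_nonempty) (simp_all add: GM_def)
      fix \<pi> assume \<pi>: "\<pi> \<in> couplings (gm_measure \<X>) (gm_measure \<Y>)"
      have "sqrt (c / 8) * r = sqrt (c / 8 * r\<^sup>2)"
        by (simp only: real_sqrt_mult real_sqrt_abs abs_of_pos[OF r])
      also have "\<dots> \<le> sqrt (\<integral>((x, y), (x', y')). \<bar>gauge \<X> x x' - gauge \<Y> y y'\<bar>\<^sup>2 \<partial>(\<pi> \<Otimes>\<^sub>M \<pi>))"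
        by (intro real_sqrt_le_mono coupling_cost_lower[OF X bdd B c sep r small Y \<pi>])
      finally show "sqrt (c / 8) * r \<le>
          sqrt (\<integral>((x, y), (x', y')). \<bar>gauge \<X> x x' - gauge \<Y> y y'\<bar>\<^sup>2 \<partial>(\<pi> \<Otimes>\<^sub>M \<pi>))" .
    qed
    then have "sqrt (c / 8) * r \<le> q_GW n \<X>"
      unfolding q_GW_def using GM_nonempty[OF n] by (intro cINF_greatest) auto
    then show "sqrt (c / 8) * \<rho> * real n powr (- (1 / real DIM('a))) \<le> q_GW n \<X>"
      by (simp add: r_def mult.assoc)
  qed
qed

section \<open>The distance and its square as gauges\<close>

lemma dist_lipschitz:
  fixes x x' z z' :: "'a::real_normed_vector"
  shows "\<bar>norm (x - x') - norm (z - z')\<bar> \<le> norm (x - z) + norm (x' - z')"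
proof -
  have "\<bar>norm (x - x') - norm (z - z')\<bar> \<le> norm ((x - x') - (z - z'))"
    by (rule norm_triangle_ineq3)
  also have "(x - x') - (z - z') = (x - z) - (x' - z')" by simp
  also have "norm \<dots> \<le> norm (x - z) + norm (x' - z')"
    by (rule norm_triangle_ineq4)
  finally show ?thesis .
qed

context bounded_prob_space
begin

lemma dist_le: "x \<in> space \<xi> \<Longrightarrow> x' \<in> space \<xi> \<Longrightarrow> norm (x - x') \<le> 2 * R"
  using norm_triangle_ineq4[of x x'] norm_less[of x] norm_less[of x'] by linarith

lemma sq_dist_le: "x \<in> space \<xi> \<Longrightarrow> x' \<in> space \<xi> \<Longrightarrow> (norm (x - x'))\<^sup>2 \<le> (2 * R)\<^sup>2"
  by (intro power_mono dist_le) auto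

lemma sq_dist_lipschitz:
  assumes "x \<in> space \<xi>" "x' \<in> space \<xi>" "z \<in> space \<xi>" "z' \<in> space \<xi>"
  shows "\<bar>(norm (x - x'))\<^sup>2 - (norm (z - z'))\<^sup>2\<bar> \<le> 4 * R * (norm (x - z) + norm (x' - z'))"
proof -
  have "\<bar>(norm (x - x'))\<^sup>2 - (norm (z - z'))\<^sup>2\<bar> =
      (norm (x - x') + norm (z - z')) * \<bar>norm (x - x') - norm (z - z')\<bar>"
    by (simp add: abs_mult power2_eq_square square_diff_square_factored)
  also have "\<dots> \<le> 4 * R * (norm (x - z) + norm (x' - z'))"
    using dist_le[OF assms(1,2)] dist_le[OF assms(3,4)] R_pos
    by (intro mult_mono dist_lipschitz) auto
  finally show ?thesis .
qed

text \<open>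
  The difference \<open>\<parallel>x - x'\<parallel>\<^sup>2 - \<parallel>z - x'\<parallel>\<^sup>2\<close> is affine in \<open>x'\<close> with linear part \<open>- 2 * ((x - z) \<bullet> x')\<close>,
  so its mean square is controlled from below by the variance in direction \<open>x - z\<close>.
\<close>
lemma sq_dist_separates:
  assumes ac: "absolutely_continuous lborel (distr \<xi> borel (\<lambda>x. x))"
  obtains c :: real where "0 < c" "\<And>x z. c * (norm (x - z))\<^sup>2 \<le>
    (\<integral>x'. ((norm (x - x'))\<^sup>2 - (norm (z - x'))\<^sup>2)\<^sup>2 \<partial>\<xi>)"
proof -
  obtain c where c: "0 < c" "\<And>u a. c * (norm u)\<^sup>2 \<le> (\<integral>x. (u \<bullet> x - a)\<^sup>2 \<partial>\<xi>)"
    using variance_inner_uniform[OF ac] by blast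
  show thesis
  proof
    show "0 < 4 * c" using c by simp
    fix x z :: 'a
    define a where "a = ((norm x)\<^sup>2 - (norm z)\<^sup>2) / 2"
    have "2 * a = x \<bullet> x - z \<bullet> z" by (simp add: a_def power2_norm_eq_inner)
    then have "(norm (x - x'))\<^sup>2 - (norm (z - x'))\<^sup>2 = - 2 * ((x - z) \<bullet> x' - a)" for x'
      by (simp add: power2_norm_eq_inner inner_diff inner_commute algebra_simps)
    then have "((norm (x - x'))\<^sup>2 - (norm (z - x'))\<^sup>2)\<^sup>2 = 4 * ((x - z) \<bullet> x' - a)\<^sup>2" for x'
      by (simp only: power_mult_distrib) simp
    then show "4 * c * (norm (x - z))\<^sup>2 \<le> (\<integral>x'. ((norm (x - x'))\<^sup>2 - (norm (z - x'))\<^sup>2)\<^sup>2 \<partial>\<xi>)"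
      using c(2)[of "x - z" a] by simp
  qed
qed

text \<open>
  Since \<open>\<parallel>x - x'\<parallel>\<^sup>2 - \<parallel>z - x'\<parallel>\<^sup>2\<close> is \<open>\<parallel>x - x'\<parallel> - \<parallel>z - x'\<parallel>\<close> times a factor of at most \<open>4 * R\<close>,
  the bound for the squared distance passes to the distance.
\<close>
lemma dist_separates:
  assumes ac: "absolutely_continuous lborel (distr \<xi> borel (\<lambda>x. x))"
  obtains c :: real where "0 < c" "\<And>x z. x \<in> space \<xi> \<Longrightarrow> z \<in> space \<xi> \<Longrightarrow>
    c * (norm (x - z))\<^sup>2 \<le> (\<integral>x'. (norm (x - x') - norm (z - x'))\<^sup>2 \<partial>\<xi>)"
proof -
  obtain c where c: "0 < c" "\<And>x z. c * (norm (x - z))\<^sup>2 \<le>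
      (\<integral>x'. ((norm (x - x'))\<^sup>2 - (norm (z - x'))\<^sup>2)\<^sup>2 \<partial>\<xi>)"
    using sq_dist_separates[OF ac] by blast
  show thesis
  proof
    show "0 < c / (4 * R)\<^sup>2" using c R_pos by simp
    fix x z assume x: "x \<in> space \<xi>" and z: "z \<in> space \<xi>"
    have ptw: "((norm (x - x'))\<^sup>2 - (norm (z - x'))\<^sup>2)\<^sup>2 \<le> (4 * R)\<^sup>2 * (norm (x - x') - norm (z - x'))\<^sup>2"
      if x': "x' \<in> space \<xi>" for x'
    proof -
      have "((norm (x - x'))\<^sup>2 - (norm (z - x'))\<^sup>2)\<^sup>2 =
          (norm (x - x') + norm (z - x'))\<^sup>2 * (norm (x - x') - norm (z - x'))\<^sup>2"
        by (simp add: power2_eq_square square_diff_square_factored flip: power_mult_distrib)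
      also have "\<dots> \<le> (4 * R)\<^sup>2 * (norm (x - x') - norm (z - x'))\<^sup>2"
        using dist_le[OF x x'] dist_le[OF z x'] by (intro mult_right_mono power_mono) auto
      finally show ?thesis .
    qed
    have int: "integrable \<xi> (\<lambda>x'. (norm (x - x') - norm (z - x'))\<^sup>2)"
    proof (rule integrable_bounded)
      fix x' assume x': "x' \<in> space \<xi>"
      have "\<bar>norm (x - x') - norm (z - x')\<bar> \<le> 2 * R"
        using dist_le[OF x x'] dist_le[OF z x'] norm_ge_zero[of "x - x'"] norm_ge_zero[of "z - x'"]
        by linarith
      then show "\<bar>(norm (x - x') - norm (z - x'))\<^sup>2\<bar> \<le> (2 * R)\<^sup>2"
        using power_mono[of "\<bar>norm (x - x') - norm (z - x')\<bar>" "2 * R" 2] by simp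
    qed measurable
    have "c * (norm (x - z))\<^sup>2 \<le> (\<integral>x'. (4 * R)\<^sup>2 * (norm (x - x') - norm (z - x'))\<^sup>2 \<partial>\<xi>)"
      using c(2) by (rule order_trans) (intro integral_mono' integrable_mult_right int ptw, auto)
    also have "\<dots> = (4 * R)\<^sup>2 * (\<integral>x'. (norm (x - x') - norm (z - x'))\<^sup>2 \<partial>\<xi>)"
      by simp
    finally show "c / (4 * R)\<^sup>2 * (norm (x - z))\<^sup>2 \<le> (\<integral>x'. (norm (x - x') - norm (z - x'))\<^sup>2 \<partial>\<xi>)"
      using R_pos by (simp add: divide_simps mult.commute)
  qed
qed

end

section \<open>The quantization rate\<close>

theorem corollary4p4:
  fixes \<X> :: "'a::euclidean_space gm" and X :: "'a set"
  assumes "gm_space \<X>"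
    and "gm_top \<X> = top_of_set X"
    and "bounded X"
    and "absolutely_continuous lborel (distr (gm_measure \<X>) borel (\<lambda>x. x))"
    and "(\<forall>x\<in>X. \<forall>x'\<in>X. gauge \<X> x x' = norm (x - x')) \<or>
         (\<forall>x\<in>X. \<forall>x'\<in>X. gauge \<X> x x' = (norm (x - x'))\<^sup>2)"
  shows "limsup (\<lambda>n. ereal (real n powr (1 / real DIM('a)) * q_GW n \<X>)) < \<infinity> \<and>
         liminf (\<lambda>n. ereal (real n powr (1 / real DIM('a)) * q_GW n \<X>)) > 0"
proof -
  define \<xi> where "\<xi> = gm_measure \<X>"
  have "sets \<xi> = sets (borel_sigma (top_of_set X))" and "prob_space \<xi>"
    using assms(1,2) by (auto simp: \<xi>_def gm_space_def Let_def)
  note \<xi> = space_borel_sigma_top_of_set[OF this(1)] this(2)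
  obtain R where "\<And>x. x \<in> X \<Longrightarrow> norm x < R"
    using assms(3) by (meson bounded_pos_less)
  then have bdd: "bounded_prob_space \<xi> R"
    using \<xi> by (simp add: bounded_prob_space_def bounded_prob_space_axioms_def)
  then interpret bounded_prob_space \<xi> R .
  have ac: "absolutely_continuous lborel (distr \<xi> borel (\<lambda>x. x))"
    using assms(4) by (simp add: \<xi>_def)
  obtain L B c where L: "0 \<le> L" and c: "0 < c"
    and sym: "\<And>x x'. x \<in> space \<xi> \<Longrightarrow> x' \<in> space \<xi> \<Longrightarrow> gauge \<X> x x' = gauge \<X> x' x"
    and lip: "\<And>x x' z z'. x \<in> space \<xi> \<Longrightarrow> x' \<in> space \<xi> \<Longrightarrow> z \<in> space \<xi> \<Longrightarrow> z' \<in> space \<xi> \<Longrightarrow>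
      \<bar>gauge \<X> x x' - gauge \<X> z z'\<bar> \<le> L * (norm (x - z) + norm (x' - z'))"
    and B: "\<And>x x'. x \<in> space \<xi> \<Longrightarrow> x' \<in> space \<xi> \<Longrightarrow> \<bar>gauge \<X> x x'\<bar> \<le> B"
    and sep: "\<And>x z. x \<in> space \<xi> \<Longrightarrow> z \<in> space \<xi> \<Longrightarrow>
      c * (norm (x - z))\<^sup>2 \<le> (\<integral>x'. (gauge \<X> x x' - gauge \<X> z x')\<^sup>2 \<partial>\<xi>)"
    using assms(5)
  proof
    assume "\<forall>x\<in>X. \<forall>x'\<in>X. gauge \<X> x x' = norm (x - x')"
    then have g: "gauge \<X> x x' = norm (x - x')" if "x \<in> space \<xi>" "x' \<in> space \<xi>" for x x'
      using that by (simp add: \<xi>(1))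
    obtain c where c: "0 < c" "\<And>x z. x \<in> space \<xi> \<Longrightarrow> z \<in> space \<xi> \<Longrightarrow>
        c * (norm (x - z))\<^sup>2 \<le> (\<integral>x'. (norm (x - x') - norm (z - x'))\<^sup>2 \<partial>\<xi>)"
      using dist_separates[OF ac] by blast
    show thesis
    proof (rule that[of 1 c "2 * R"])
      show "c * (norm (x - z))\<^sup>2 \<le> (\<integral>x'. (gauge \<X> x x' - gauge \<X> z x')\<^sup>2 \<partial>\<xi>)"
        if "x \<in> space \<xi>" "z \<in> space \<xi>" for x z
        using c(2)[OF that] that by (simp add: g cong: Bochner_Integration.integral_cong)
    qed (use c(1) dist_lipschitz dist_le in \<open>simp_all add: g norm_minus_commute\<close>)
  next
    assume "\<forall>x\<in>X. \<forall>x'\<in>X. gauge \<X> x x' = (norm (x - x'))\<^sup>2"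
    then have g: "gauge \<X> x x' = (norm (x - x'))\<^sup>2" if "x \<in> space \<xi>" "x' \<in> space \<xi>" for x x'
      using that by (simp add: \<xi>(1))
    obtain c where c: "0 < c" "\<And>x z. c * (norm (x - z))\<^sup>2 \<le>
        (\<integral>x'. ((norm (x - x'))\<^sup>2 - (norm (z - x'))\<^sup>2)\<^sup>2 \<partial>\<xi>)"
      using sq_dist_separates[OF ac] by blast
    show thesis
    proof (rule that[of "4 * R" c "(2 * R)\<^sup>2"])
      show "c * (norm (x - z))\<^sup>2 \<le> (\<integral>x'. (gauge \<X> x x' - gauge \<X> z x')\<^sup>2 \<partial>\<xi>)"
        if "x \<in> space \<xi>" "z \<in> space \<xi>" for x z
        using c(2)[of x z] that by (simp add: g cong: Bochner_Integration.integral_cong)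
      show "\<bar>gauge \<X> x x'\<bar> \<le> (2 * R)\<^sup>2" if "x \<in> space \<xi>" "x' \<in> space \<xi>" for x x'
        using that sq_dist_le[OF that] by (simp add: g)
    qed (use c(1) R_pos sq_dist_lipschitz in \<open>simp_all add: g norm_minus_commute\<close>)
  qed
  define s where "s n = real n powr (1 / real DIM('a))" for n :: nat
  define t where "t n = real n powr (- (1 / real DIM('a)))" for n :: nat
  define C where "C = 8 * L * R * real DIM('a)"
  have st: "s n * t n = 1" if "1 \<le> n" for n
    using that by (simp add: s_def t_def flip: powr_add)
  have s_nonneg: "0 \<le> s n" for n by (simp add: s_def)
  have upper: "s n * q_GW n \<X> \<le> C" if n: "1 \<le> n" for n
  proof -
    have "q_GW n \<X> \<le> C * t n"
      unfolding C_def t_def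
      by (rule quantization_upper[OF assms(1) bdd[unfolded \<xi>_def] n L sym[unfolded \<xi>_def] lip[unfolded \<xi>_def]])
    then have "s n * q_GW n \<X> \<le> s n * (C * t n)"
      using s_nonneg by (rule mult_left_mono)
    also have "\<dots> = C * (s n * t n)" by simp
    finally show ?thesis using st[OF n] by simp
  qed
  obtain \<kappa> where \<kappa>: "0 < \<kappa>" "\<And>n. 1 \<le> n \<Longrightarrow> \<kappa> * t n \<le> q_GW n \<X>"
    using quantization_lower[OF assms(1) bdd[unfolded \<xi>_def] assms(4) B[unfolded \<xi>_def] c sep[unfolded \<xi>_def]]
    unfolding t_def by blast
  have lower: "\<kappa> \<le> s n * q_GW n \<X>" if n: "1 \<le> n" for n
  proof -
    have "s n * (\<kappa> * t n) \<le> s n * q_GW n \<X>"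
      using \<kappa>(2)[OF n] s_nonneg by (rule mult_left_mono)
    moreover have "s n * (\<kappa> * t n) = \<kappa> * (s n * t n)" by simp
    ultimately show ?thesis using st[OF n] by simp
  qed
  have "limsup (\<lambda>n. ereal (s n * q_GW n \<X>)) \<le> ereal C"
    using upper by (intro Limsup_bounded eventually_sequentiallyI[of 1]) simp
  also have "\<dots> < \<infinity>" by simp
  finally have "limsup (\<lambda>n. ereal (s n * q_GW n \<X>)) < \<infinity>" .
  moreover have "0 < ereal \<kappa>" using \<kappa>(1) by simp
  moreover have "ereal \<kappa> \<le> liminf (\<lambda>n. ereal (s n * q_GW n \<X>))"
    using lower by (intro Liminf_bounded eventually_sequentiallyI[of 1]) simp
  ultimately show ?thesis
    unfolding s_def by (meson order_less_le_trans)
qed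

end
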